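(* Let $X$ be a finite metric space of negative type, and suppose $X$ admits a microscopic weighting $\widehat{\mathbf{w}}$. Then $\widehat{\mathbf{w}}$ maximizes the energy integral $I$ over the signed measures of mass one on $X$ (i.e. $I(\widehat{\mathbf{w}})=M(X)$), and $$M(X)=\mu_X'(0).$$ In particular, this holds for every finite metric space of strictly negative type.
   Context: For a finite (nonempty) metric space $X=\{x_1,\dots,x_n\}$ with metric $d$, let $D=(d(x_i,x_j))_{i,j}$ be the distance matrix and, for $t>0$, $Z(t)=(e^{-t d(x_i,x_j)})_{i,j}$. Write $\mathbf{1}=(1,\dots,1)^{\mathrm T}\in\mathbb{R}^n$. For all sufficiently small $t>0$, $Z(t)$ is invertible; put $\mathbf{w}(t)=Z(t)^{-1}\mathbf{1}$, and let $\mu_X(t)=\mathbf{1}^{\mathrm T}\mathbf{w}(t)$ (the magnitude function). $X$ admits a microscopic weighting if $\widehat{\mathbf{w}}:=\lim_{t\to0^+}\mathbf{w}(t)$ exists componentwise in $\mathbb{R}^n$; then $\widehat{\mathbf{w}}$ is the microscopic weighting. In that case $\mu_X$, extended by $\mu_X(0)=\lim_{t\to0^+}\mu_X(t)=1$, is (one-sidedly) differentiable at $0$, and $\mu_X'(0)$ denotes the derivative. $X$ is of negative type if $\mathbf{u}^{\mathrm T}D\mathbf{u}\le0$ for every $\mathbf{u}\in\mathbb{R}^n$ with $\mathbf{1}^{\mathrm T}\mathbf{u}=0$, and of strictly negative type if moreover equality holds only for $\mathbf{u}=\mathbf{0}$. Signed measures on $X$ are identified with vectors in $\mathbb{R}^n$,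 and the signed measures of mass one form $\mathcal{M}_1(X)=\{\mathbf{v}\in\mathbb{R}^n:\mathbf{1}^{\mathrm T}\mathbf{v}=1\}$. The energy of $\mathbf{v}\in\mathcal{M}_1(X)$ is $I(\mathbf{v})=\iint_{X\times X} d\,\mathrm{d}\mathbf{v}\,\mathrm{d}\mathbf{v}=\mathbf{v}^{\mathrm T}D\mathbf{v}$, and the maximal energy is $M(X)=\sup\{I(\mathbf{v}):\mathbf{v}\in\mathcal{M}_1(X)\}$. *)

theory Defs
  imports "HOL-Analysis.Analysis"
begin

text \<open>
  A finite nonempty metric space is a finite (automatically nonempty) index type \<open>'n\<close> with a
  distance \<open>d\<close> such that \<open>Metric_space UNIV d\<close>. The constant \<open>1 :: real ^ 'n\<close> is the all-ones
  vector, so \<open>1 \<bullet> v\<close> is the sum of the components of \<open>v\<close>.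
\<close>

definition distance_matrix :: "('n \<Rightarrow> 'n \<Rightarrow> real) \<Rightarrow> real ^ 'n::finite ^ 'n" where
  "distance_matrix d = (\<chi> i j. d i j)"

definition similarity_matrix :: "('n \<Rightarrow> 'n \<Rightarrow> real) \<Rightarrow> real \<Rightarrow> real ^ 'n::finite ^ 'n" where
  "similarity_matrix d t = (\<chi> i j. exp (- t * d i j))"

text \<open>
  Since \<open>similarity_matrix d t\<close> is invertible for all sufficiently small \<open>t > 0\<close>, the arbitrary
  value of \<open>matrix_inv\<close> at singular matrices does not affect limits as \<open>t\<close> tends to 0 from the right.
\<close>

definition weighting :: "('n \<Rightarrow> 'n \<Rightarrow> real) \<Rightarrow> real \<Rightarrow> real ^ 'n::finite" where
  "weighting d t = matrix_inv (similarity_matrix d t) *v 1"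

text \<open>
  The value 1 at 0 is the extension by continuity when there is a microscopic weighting.
  A one-sided derivative at 0 of the extended function can exist only if the limit from the right
  is indeed 1.
\<close>

definition magnitude :: "('n::finite \<Rightarrow> 'n \<Rightarrow> real) \<Rightarrow> real \<Rightarrow> real" where
  "magnitude d t = (if t = 0 then 1 else 1 \<bullet> weighting d t)"

text \<open>Convergence in \<open>real ^ 'n\<close> is componentwise convergence.\<close>

definition admits_microscopic_weighting :: "('n::finite \<Rightarrow> 'n \<Rightarrow> real) \<Rightarrow> bool" where
  "admits_microscopic_weighting d \<longleftrightarrow> (\<exists>w. (weighting d \<longlongrightarrow> w) (at_right 0))"

definition microscopic_weighting :: "('n \<Rightarrow> 'n \<Rightarrow> real) \<Rightarrow> real ^ 'n::finite" where
  "microscopic_weighting d = Lim (at_right 0) (weighting d)"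

definition negative_type :: "('n::finite \<Rightarrow> 'n \<Rightarrow> real) \<Rightarrow> bool" where
  "negative_type d \<longleftrightarrow> (\<forall>u :: real ^ 'n. 1 \<bullet> u = 0 \<longrightarrow> u \<bullet> (distance_matrix d *v u) \<le> 0)"

definition strictly_negative_type :: "('n::finite \<Rightarrow> 'n \<Rightarrow> real) \<Rightarrow> bool" where
  "strictly_negative_type d \<longleftrightarrow> negative_type d \<and>
     (\<forall>u :: real ^ 'n. 1 \<bullet> u = 0 \<and> u \<bullet> (distance_matrix d *v u) = 0 \<longrightarrow> u = 0)"

definition mass_one :: "(real ^ 'n::finite) set" where
  "mass_one = {v. 1 \<bullet> v = 1}"

definition energy :: "('n \<Rightarrow> 'n \<Rightarrow> real) \<Rightarrow> real ^ 'n::finite \<Rightarrow> real" where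
  "energy d v = v \<bullet> (distance_matrix d *v v)"

text \<open>Extended-real valued, because the energy may be unbounded on signed measures of mass one.\<close>

definition maximal_energy :: "('n::finite \<Rightarrow> 'n \<Rightarrow> real) \<Rightarrow> ereal" where
  "maximal_energy d = (SUP v \<in> (mass_one :: (real ^ 'n) set). ereal (energy d v))"

end

theory Submission
  imports Defs "HOL-Complex_Analysis.Complex_Analysis" "HOL-Real_Asymp.Real_Asymp"
begin

text \<open>
  Put \<open>E t = (Z t - J) / t\<close>, where \<open>J\<close> is the all-ones matrix and \<open>Z t\<close> the similarity matrix;
  then \<open>E t\<close> tends to \<open>- D\<close>. The weighting equation \<open>Z t w = 1\<close> says that \<open>E t w = - s 1\<close> with
  \<open>s = (1 \<bullet> w - 1) / t\<close>, the difference quotient of the magnitude at 0. If \<open>w\<close> converges to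
  \<open>v\<close>, then \<open>s\<close> converges to some \<open>m\<close> with \<open>D v = m 1\<close> and \<open>1 \<bullet> v = 1\<close>, so \<open>v\<close> is a critical
  point of the energy on the measures of mass one, with energy \<open>m\<close>. Negative type makes the
  energy concave there, so \<open>v\<close> is a maximizer. Strictly negative type makes the limiting bordered system
  \<open>D w - s 1 = 0\<close>, \<open>1 \<bullet> w = 1\<close> in \<open>(w, s)\<close> uniquely solvable, and the solution then depends
  continuously on \<open>t\<close>. Finally, \<open>det (Z t)\<close> extends to an entire function of \<open>t\<close> that tends to 1
  along the positive reals, so it has no zeros in a punctured neighbourhood of 0.
\<close>

lemma inner_one_vec: "1 \<bullet> v = (\<Sum>i\<in>UNIV. v $ i)" for v :: "real ^ 'n::finite"
  by (simp add: inner_vec_def)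

lemma tendsto_det:
  fixes A :: "'b \<Rightarrow> real ^ 'n::finite ^ 'n"
  assumes "(A \<longlongrightarrow> B) F"
  shows "((\<lambda>t. det (A t)) \<longlongrightarrow> det B) F"
  unfolding det_def by (intro tendsto_intros assms)

lemma tendsto_matrix_vector_mult:
  fixes A :: "'b \<Rightarrow> real ^ 'n::finite ^ 'm::finite"
  assumes "(A \<longlongrightarrow> B) F" "(x \<longlongrightarrow> y) F"
  shows "((\<lambda>t. A t *v x t) \<longlongrightarrow> B *v y) F"
  by (intro vec_tendstoI) (auto simp: matrix_vector_mult_def intro!: tendsto_intros assms)

lemma eventually_invertible_similarity_matrix:
  fixes d :: "'n::finite \<Rightarrow> 'n \<Rightarrow> real"
  assumes d: "Metric_space UNIV d"
  shows "\<forall>\<^sub>F t in at_right 0. invertible (similarity_matrix d t)"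
proof -
  interpret Metric_space UNIV d by (rule d)
  \<comment> \<open>The Leibniz expansion of \<open>det (similarity_matrix d t)\<close> with
    \<open>t\<close> made complex, so that its zeros can be isolated by complex analysis.\<close>
  define f where "f z = (\<Sum>p | p permutes (UNIV :: 'n set). of_int (sign p) *
    (\<Prod>i\<in>UNIV. exp (- z * of_real (d i (p i)))))" for z :: complex
  have f_real: "f (of_real t) = of_real (det (similarity_matrix d t))" for t
    by (simp add: f_def det_def similarity_matrix_def flip: exp_of_real)
  have "((\<lambda>t. exp (- t * d i j)) \<longlongrightarrow> (if i = j then 1 else 0)) at_top" for i j
  proof (cases "i = j")
    case False
    then have "d i j > 0" by (simp add: mdist_pos_less)
    then show ?thesis using False by simp real_asymp
  qed simp
  then have "(similarity_matrix d \<longlongrightarrow> mat 1) at_top"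
    by (intro vec_tendstoI) (simp add: similarity_matrix_def mat_def)
  then have "((\<lambda>t. det (similarity_matrix d t)) \<longlongrightarrow> 1) at_top"
    using tendsto_det by fastforce
  then have "\<forall>\<^sub>F t in at_top. det (similarity_matrix d t) \<noteq> 0"
    by (rule tendsto_imp_eventually_ne) simp
  then obtain t\<^sub>0 where "det (similarity_matrix d t\<^sub>0) \<noteq> 0"
    using eventually_happens by force
  then have "f (of_real t\<^sub>0) \<noteq> 0" by (simp add: f_real)
  moreover have "f holomorphic_on UNIV"
    unfolding f_def by (intro holomorphic_intros)
  \<comment> \<open>Zeros of an entire function that is not identically zero are isolated. The value
    \<open>f 0\<close> may vanish, and does when there are at least two points.\<close>
  ultimately have "\<forall>\<^sub>F z in at 0. f z \<noteq> 0"
    using non_zero_neighbour_alt[of f UNIV 0] by auto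
  moreover have "filterlim (of_real :: real \<Rightarrow> complex) (at 0) (at_right 0)"
    unfolding filterlim_at
    by (auto intro!: tendsto_eq_intros simp: eventually_at_filter)
  ultimately have "\<forall>\<^sub>F t in at_right 0. f (of_real t) \<noteq> 0"
    by (rule eventually_compose_filterlim)
  then show ?thesis
    by (simp add: f_real invertible_det_nz)
qed

text \<open>The matrix \<open>E t\<close> of the overview. Division by zero makes it the zero matrix
  at 0, but only its limit from the right matters.\<close>

definition similarity_quotient :: "('n \<Rightarrow> 'n \<Rightarrow> real) \<Rightarrow> real \<Rightarrow> real ^ 'n::finite ^ 'n" where
  "similarity_quotient d t = (\<chi> i j. (exp (- t * d i j) - 1) / t)"

lemma tendsto_similarity_quotient:
  "(similarity_quotient d \<longlongrightarrow> - distance_matrix d) (at_right 0)"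
proof -
  have "((\<lambda>t. (exp (- t * a) - 1) / t) \<longlongrightarrow> - a) (at_right 0)" for a :: real
    by real_asymp
  then show ?thesis
    by (intro vec_tendstoI) (simp add: similarity_quotient_def distance_matrix_def)
qed

text \<open>Subtract \<open>J w = (1 \<bullet> w) 1\<close> from \<open>Z t w = 1\<close> and divide
  by \<open>t\<close>.\<close>

lemma similarity_quotient_weighting:
  fixes d :: "'n::finite \<Rightarrow> 'n \<Rightarrow> real"
  assumes "invertible (similarity_matrix d t)" "t \<noteq> 0"
  shows "similarity_quotient d t *v weighting d t = - ((1 \<bullet> weighting d t - 1) / t) *\<^sub>R 1"
proof -
  have "similarity_matrix d t *v weighting d t = 1"
    using someI_ex[of "\<lambda>B. similarity_matrix d t ** B = mat 1 \<and> B ** similarity_matrix d t = mat 1"]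
      assms(1) by (simp add: weighting_def matrix_vector_mul_assoc matrix_inv_def invertible_def)
  then have "(\<Sum>j\<in>UNIV. exp (- t * d i j) * weighting d t $ j) = 1" for i
    by (simp add: vec_eq_iff matrix_vector_mult_def similarity_matrix_def)
  then have "(\<Sum>j\<in>UNIV. (exp (- t * d i j) - 1) / t * weighting d t $ j)
      = (1 - (\<Sum>j\<in>UNIV. weighting d t $ j)) / t" for i
    by (simp add: left_diff_distrib sum_subtractf diff_divide_distrib flip: sum_divide_distrib)
  then show ?thesis
    by (simp add: vec_eq_iff matrix_vector_mult_def similarity_quotient_def inner_one_vec
        diff_divide_distrib)
qed

lemma eventually_similarity_quotient_weighting:
  fixes d :: "'n::finite \<Rightarrow> 'n \<Rightarrow> real"
  assumes "Metric_space UNIV d"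
  shows "\<forall>\<^sub>F t in at_right 0.
    similarity_quotient d t *v weighting d t = - ((1 \<bullet> weighting d t - 1) / t) *\<^sub>R 1"
  using eventually_invertible_similarity_matrix[OF assms] eventually_at_right_less
  by eventually_elim (simp add: similarity_quotient_weighting)

lemma microscopic_limit_equations:
  fixes d :: "'n::finite \<Rightarrow> 'n \<Rightarrow> real"
  assumes "Metric_space UNIV d" and w: "(weighting d \<longlongrightarrow> v) (at_right 0)"
  obtains m where "((\<lambda>t. (1 \<bullet> weighting d t - 1) / t) \<longlongrightarrow> m) (at_right 0)"
    "distance_matrix d *v v = m *\<^sub>R 1" "1 \<bullet> v = 1"
proof -
  let ?s = "\<lambda>t. (1 \<bullet> weighting d t - 1) / t"
  have neg_mult: "- distance_matrix d *v v = - (distance_matrix d *v v)"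
    by (simp add: vec_eq_iff matrix_vector_mult_def sum_negf)
  have "((\<lambda>t. similarity_quotient d t *v weighting d t) \<longlongrightarrow> - distance_matrix d *v v) (at_right 0)"
    by (intro tendsto_matrix_vector_mult tendsto_similarity_quotient w)
  then have "((\<lambda>t. - ?s t *\<^sub>R 1) \<longlongrightarrow> - distance_matrix d *v v) (at_right 0)"
    by (rule Lim_transform_eventually)
      (use eventually_similarity_quotient_weighting[OF assms(1)] in simp)
  then have "((\<lambda>t. - (- ?s t *\<^sub>R 1)) \<longlongrightarrow> - (- distance_matrix d *v v)) (at_right 0)"
    by (rule tendsto_minus)
  then have lim: "((\<lambda>t. ?s t *\<^sub>R 1) \<longlongrightarrow> distance_matrix d *v v) (at_right 0)"
    by (simp add: neg_mult)
  have s: "(?s \<longlongrightarrow> (distance_matrix d *v v) $ i) (at_right 0)" for i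
    using tendsto_vec_nth[OF lim, of i] by simp
  \<comment> \<open>All coordinates of \<open>D v\<close> are limits of the same scalar
    \<open>?s\<close>, hence equal; \<open>undefined\<close> is just an arbitrary index.\<close>
  define m where "m = (distance_matrix d *v v) $ undefined"
  have sm: "(?s \<longlongrightarrow> m) (at_right 0)"
    using s unfolding m_def .
  have "distance_matrix d *v v = m *\<^sub>R 1"
    using tendsto_unique[OF _ s sm] by (simp add: vec_eq_iff)
  \<comment> \<open>For nonzero \<open>t\<close> this expression is the mass of the weighting, so
    convergence of \<open>?s\<close> forces the limit to have mass one.\<close>
  moreover have "((\<lambda>t. 1 + t * ?s t) \<longlongrightarrow> 1 + 0 * m) (at_right 0)"
    by (intro tendsto_intros sm)
  then have "((\<lambda>t. 1 \<bullet> weighting d t) \<longlongrightarrow> 1) (at_right 0)"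
    by (auto elim!: Lim_transform_eventually simp: eventually_at_filter)
  then have "1 \<bullet> v = 1"
    using tendsto_unique tendsto_inner[OF tendsto_const w, of 1] trivial_limit_at_right_real by blast
  ultimately show ?thesis using that sm by blast
qed

text \<open>In the expansion of the energy at \<open>v + x\<close> with \<open>x\<close> of mass
  zero, both cross terms are \<open>m (1 \<bullet> x) = 0\<close> by symmetry of \<open>D\<close>,
  and the constant term is \<open>m\<close>. The quadratic term is nonpositive by negative
  type.\<close>

lemma energy_le_critical:
  fixes d :: "'n::finite \<Rightarrow> 'n \<Rightarrow> real"
  assumes sym: "\<And>i j. d i j = d j i" and neg: "negative_type d"
    and v: "distance_matrix d *v v = m *\<^sub>R 1" "1 \<bullet> v = 1" and u: "1 \<bullet> u = 1"
  shows "energy d u \<le> m"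
proof -
  define x where "x = u - v"
  have x: "1 \<bullet> x = 0" using u v by (simp add: x_def inner_diff_right)
  have "transpose (distance_matrix d) = distance_matrix d"
    using sym by (simp add: transpose_def distance_matrix_def vec_eq_iff)
  then have "v \<bullet> (distance_matrix d *v x) = x \<bullet> (distance_matrix d *v v)"
    by (metis dot_lmul_matrix inner_commute vector_transpose_matrix)
  moreover have "u = v + x" by (simp add: x_def)
  ultimately have "energy d u = m + x \<bullet> (distance_matrix d *v x)"
    using x v by (simp add: energy_def matrix_vector_right_distrib inner_add inner_commute)
  then show ?thesis using neg x by (simp add: negative_type_def)
qed

lemma microscopic_weighting_maximizes:
  fixes d :: "'n::finite \<Rightarrow> 'n \<Rightarrow> real"
  assumes d: "Metric_space UNIV d" and neg: "negative_type d"
    and adm: "admits_microscopic_weighting d"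
  shows "microscopic_weighting d \<in> mass_one \<and>
    (\<forall>v\<in>mass_one. energy d v \<le> energy d (microscopic_weighting d)) \<and>
    ereal (energy d (microscopic_weighting d)) = maximal_energy d \<and>
    (\<exists>m. (magnitude d has_real_derivative m) (at 0 within {0..}) \<and> maximal_energy d = ereal m)"
proof -
  interpret Metric_space UNIV d by (rule d)
  let ?w = "microscopic_weighting d"
  have w: "(weighting d \<longlongrightarrow> ?w) (at_right 0)"
    using adm unfolding admits_microscopic_weighting_def microscopic_weighting_def
    by (metis tendsto_Lim trivial_limit_at_right_real)
  obtain m where m: "((\<lambda>t. (1 \<bullet> weighting d t - 1) / t) \<longlongrightarrow> m) (at_right 0)"
    and Dw: "distance_matrix d *v ?w = m *\<^sub>R 1" and mass: "1 \<bullet> ?w = 1"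
    using microscopic_limit_equations[OF d w] .
  have energy: "energy d ?w = m"
    using Dw mass by (simp add: energy_def inner_commute)
  have max: "energy d v \<le> m" if "v \<in> mass_one" for v
    using energy_le_critical[OF commute neg Dw mass] that by (simp add: mass_one_def)
  have "maximal_energy d = ereal m"
    unfolding maximal_energy_def
    by (rule SUP_eqI) (use max energy mass in \<open>auto simp: mass_one_def\<close>)
  \<comment> \<open>Since \<open>magnitude d 0 = 1\<close>, the difference quotient at 0 is exactly
    the scalar whose limit is \<open>m\<close>.\<close>
  moreover have "(magnitude d has_real_derivative m) (at 0 within {0..})"
  proof -
    have "((\<lambda>t. (magnitude d t - magnitude d 0) / (t - 0)) \<longlongrightarrow> m) (at_right 0)"
      by (rule Lim_transform_eventually[OF m])
        (auto simp: magnitude_def eventually_at_filter)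
    then show ?thesis
      by (simp add: has_field_derivative_iff at_within_Ici_at_right)
  qed
  ultimately show ?thesis
    using max energy mass by (auto simp: mass_one_def)
qed

text \<open>The residual is small only relative to \<open>x t\<close>, which is not known to be
  bounded. As \<open>L\<close> is bounded below by some \<open>c\<close>, the part of the residual
  due to \<open>x t - y\<close> can be absorbed once \<open>e t\<close> is below
  \<open>c / 2\<close>.\<close>

lemma tendsto_of_injective_linear_residual:
  fixes L :: "'a::real_normed_vector \<Rightarrow> 'c::euclidean_space"
  assumes "linear L" "inj L"
    and res: "\<forall>\<^sub>F t in F. norm (L (x t) - L y) \<le> e t * norm (x t)"
    and e: "(e \<longlongrightarrow> 0) F"
  shows "(x \<longlongrightarrow> y) F"
proof -
  obtain c where c: "c > 0" "\<And>z. c * norm z \<le> norm (L z)"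
    using linear_inj_bounded_below_pos[OF assms(1,2)] by blast
  have "\<forall>\<^sub>F t in F. \<bar>e t\<bar> < c / 2"
    using order_tendstoD(2)[OF tendsto_rabs_zero[OF e], of "c / 2"] c(1) by simp
  with res have "\<forall>\<^sub>F t in F. norm (x t - y) \<le> \<bar>e t\<bar> * (2 * norm y / c)"
  proof eventually_elim
    case (elim t)
    have "norm (x t) \<le> norm (x t - y) + norm y"
      using norm_triangle_ineq[of "x t - y" y] by simp
    then have "\<bar>e t\<bar> * norm (x t) \<le> \<bar>e t\<bar> * norm (x t - y) + \<bar>e t\<bar> * norm y"
      by (metis abs_ge_zero distrib_left mult_left_mono)
    moreover have "e t * norm (x t) \<le> \<bar>e t\<bar> * norm (x t)"
      by (simp add: mult_right_mono)
    moreover have "\<bar>e t\<bar> * norm (x t - y) \<le> c / 2 * norm (x t - y)"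
      using elim by (intro mult_right_mono) auto
    moreover have "c * norm (x t - y) \<le> norm (L (x t) - L y)"
      using c(2)[of "x t - y"] linear_diff[OF assms(1)] by simp
    ultimately have "c / 2 * norm (x t - y) \<le> \<bar>e t\<bar> * norm y"
      using elim(1) by linarith
    then show ?case using c(1) by (simp add: field_simps)
  qed
  moreover have "((\<lambda>t. \<bar>e t\<bar> * (2 * norm y / c)) \<longlongrightarrow> 0) F"
    by (intro tendsto_mult_left_zero tendsto_rabs_zero e)
  ultimately have "((\<lambda>t. x t - y) \<longlongrightarrow> 0) F"
    by (rule Lim_null_comparison)
  then show ?thesis by (simp add: LIM_zero_iff)
qed

lemma strictly_negative_type_imp_admits:
  fixes d :: "'n::finite \<Rightarrow> 'n \<Rightarrow> real"
  assumes d: "Metric_space UNIV d" and strict: "strictly_negative_type d"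
  shows "admits_microscopic_weighting d"
proof -
  define L :: "(real ^ 'n) \<times> real \<Rightarrow> (real ^ 'n) \<times> real"
    where "L z = (distance_matrix d *v fst z - snd z *\<^sub>R 1, 1 \<bullet> fst z)" for z
  have lin: "linear L"
    by (rule linearI) (simp_all add: L_def matrix_vector_right_distrib inner_add_right
        scaleR_add_left matrix_vector_mult_scaleR algebra_simps)
  moreover have inj: "inj L"
    unfolding linear_injective_0[OF lin]
  proof (intro allI impI)
    fix z assume "L z = 0"
    then have z: "distance_matrix d *v fst z = snd z *\<^sub>R 1" "1 \<bullet> fst z = 0"
      by (simp_all add: L_def prod_eq_iff)
    \<comment> \<open>Pairing the first equation with \<open>fst z\<close> gives
      \<open>snd z * (1 \<bullet> fst z) = 0\<close>, so strictness applies.\<close>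
    then have "fst z = 0"
      using strict unfolding strictly_negative_type_def by (simp add: inner_commute)
    with z show "z = 0" by (simp add: prod_eq_iff vec_eq_iff)
  qed
  ultimately obtain z where z: "L z = (0, 1)"
    using linear_injective_imp_surjective by (metis surjD)
  define R where "R t = distance_matrix d + similarity_quotient d t" for t
  define s where "s t = (1 \<bullet> weighting d t - 1) / t" for t
  \<comment> \<open>The entry sum bounds the operator norm of \<open>R t\<close>; the term in
    \<open>t\<close> accounts for the mass defect \<open>t * s t\<close>.\<close>
  define e where "e t = (\<Sum>i\<in>UNIV. \<Sum>j\<in>UNIV. \<bar>R t $ i $ j\<bar>) + \<bar>t\<bar>" for t
  have "(R \<longlongrightarrow> distance_matrix d + - distance_matrix d) (at_right 0)"
    unfolding R_def by (intro tendsto_intros tendsto_similarity_quotient)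
  then have "(R \<longlongrightarrow> 0) (at_right 0)" by simp
  then have "((\<lambda>t. R t $ i $ j) \<longlongrightarrow> 0) (at_right 0)" for i j
    using tendsto_vec_nth[OF tendsto_vec_nth] by fastforce
  then have e: "(e \<longlongrightarrow> 0) (at_right 0)"
    unfolding e_def by (intro tendsto_add_zero tendsto_null_sum tendsto_rabs_zero tendsto_ident_at)
  have "\<forall>\<^sub>F t in at_right 0.
      norm (L (weighting d t, s t) - L z) \<le> e t * norm (weighting d t, s t)"
    using eventually_similarity_quotient_weighting[OF d] eventually_at_right_less
  proof eventually_elim
    case (elim t)
    let ?x = "(weighting d t, s t)"
    \<comment> \<open>Here \<open>E t w = - s 1\<close> turns \<open>D w - s 1\<close> into
      \<open>R t w\<close>.\<close>
    have "L ?x - L z = (R t *v weighting d t, t * s t)"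
      unfolding z using elim by (simp add: L_def R_def s_def matrix_vector_mult_add_rdistrib)
    then have "norm (L ?x - L z) \<le> norm (R t *v weighting d t) + \<bar>t\<bar> * \<bar>s t\<bar>"
      using norm_Pair_le[of "R t *v weighting d t" "t * s t"] by (simp add: abs_mult)
    also have "norm (R t *v weighting d t) \<le> onorm ((*v) (R t)) * norm (weighting d t)"
      by (simp add: onorm matrix_vector_mul_bounded_linear)
    also have "\<dots> \<le> (\<Sum>i\<in>UNIV. \<Sum>j\<in>UNIV. \<bar>R t $ i $ j\<bar>) * norm (weighting d t)"
      by (intro mult_right_mono onorm_le_matrix_component_sum norm_ge_zero)
    also have "\<dots> \<le> (\<Sum>i\<in>UNIV. \<Sum>j\<in>UNIV. \<bar>R t $ i $ j\<bar>) * norm ?x"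
      using norm_fst_le[of "weighting d t" "s t"] by (intro mult_left_mono) (auto intro!: sum_nonneg)
    also have "\<bar>t\<bar> * \<bar>s t\<bar> \<le> \<bar>t\<bar> * norm ?x"
      using norm_snd_le[of "s t" "weighting d t"] by (intro mult_left_mono) auto
    finally show ?case by (simp add: e_def distrib_right)
  qed
  then have "((\<lambda>t. (weighting d t, s t)) \<longlongrightarrow> z) (at_right 0)"
    by (rule tendsto_of_injective_linear_residual[OF lin inj _ e])
  from tendsto_fst[OF this] show ?thesis
    unfolding admits_microscopic_weighting_def by auto
qed

theorem theorem5p10:
  fixes d :: "'n::finite \<Rightarrow> 'n \<Rightarrow> real"
  assumes "Metric_space UNIV d"
  shows "(negative_type d \<and> admits_microscopic_weighting d \<longrightarrow>
            microscopic_weighting d \<in> mass_one \<and>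
            (\<forall>v\<in>mass_one. energy d v \<le> energy d (microscopic_weighting d)) \<and>
            ereal (energy d (microscopic_weighting d)) = maximal_energy d \<and>
            (\<exists>m. (magnitude d has_real_derivative m) (at 0 within {0..}) \<and>
                 maximal_energy d = ereal m)) \<and>
         (strictly_negative_type d \<longrightarrow>
            admits_microscopic_weighting d \<and>
            microscopic_weighting d \<in> mass_one \<and>
            (\<forall>v\<in>mass_one. energy d v \<le> energy d (microscopic_weighting d)) \<and>
            ereal (energy d (microscopic_weighting d)) = maximal_energy d \<and>
            (\<exists>m. (magnitude d has_real_derivative m) (at 0 within {0..}) \<and>
                 maximal_energy d = ereal m))"
  using microscopic_weighting_maximizes[OF assms] strictly_negative_type_imp_admits[OF assms]
  unfolding strictly_negative_type_def by blast

end
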